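(* Let $T$ be a minimal homeomorphism of a compact metric space $X$, let $G$ be a nilpotent locally compact second countable group, let $f\colon X\to G$ be a continuous regular cocycle, let $C\subseteq X\times G$ be a surjective $\mathbf T_f$-orbit closure and $H=\mathrm{Stab}(C)$. Then (1) for every $x\in X$ there is $g_x\in G$ with $C_x=\{g\in G:(x,g)\in C\}=g_xH$; and (2) the map $\gamma\colon X\to G/H$, $\gamma(x)=g_xH$, is continuous.
   Context: The cocycle is $f(n,x)=f(T^{n-1}x)\cdots f(x)$ for $n\ge1$, $f(0,x)=\mathbf 1_G$, $f(n,x)=f(-n,T^nx)^{-1}$ for $n<0$. The skew product is $\mathbf T_f(x,g)=(Tx,f(x)g)$. A surjective $\mathbf T_f$-orbit closure is the closure of the $\mathbf T_f$-orbit of a single point which projects onto all of $X$; $f$ is regular if one exists. $\mathrm{Stab}(C)=\{h\in G:R_h(C)=C\}$ with $R_h(x,g)=(x,gh^{-1})$. *)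

theory Defs
  imports "HOL-Analysis.Analysis"
begin

(* Groups G are written additively via the class group_add, which is NOT
   assumed commutative: g + h is the group product gh, 0 is 1_G, -g is g^{-1}. *)

definition gcomm :: "'g::group_add \<Rightarrow> 'g \<Rightarrow> 'g" where
  "gcomm a b = - a + - b + a + b"

inductive_set gen_subgroup :: "'g::group_add set \<Rightarrow> 'g set" for S where
  gen_zero: "0 \<in> gen_subgroup S"
| gen_base: "s \<in> S \<Longrightarrow> s \<in> gen_subgroup S"
| gen_add: "a \<in> gen_subgroup S \<Longrightarrow> b \<in> gen_subgroup S \<Longrightarrow> a + b \<in> gen_subgroup S"
| gen_uminus: "a \<in> gen_subgroup S \<Longrightarrow> - a \<in> gen_subgroup S"

fun lower_central :: "nat \<Rightarrow> 'g::group_add set" where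
  "lower_central 0 = UNIV"
| "lower_central (Suc i) = gen_subgroup {gcomm a b | a b. a \<in> lower_central i}"

definition nilpotent_group :: "'g::group_add itself \<Rightarrow> bool" where
  "nilpotent_group _ \<longleftrightarrow> (\<exists>c. lower_central c = ({0} :: 'g set))"

definition homeomorphism_of :: "('x::topological_space \<Rightarrow> 'x) \<Rightarrow> bool" where
  "homeomorphism_of T \<longleftrightarrow> (\<exists>T'. homeomorphism UNIV UNIV T T')"

definition minimal_hom :: "('x::topological_space \<Rightarrow> 'x) \<Rightarrow> bool" where
  "minimal_hom T \<longleftrightarrow> homeomorphism_of T \<and>
     (\<forall>A. closed A \<and> T ` A = A \<longrightarrow> A = {} \<or> A = UNIV)"

definition skew :: "('x \<Rightarrow> 'x) \<Rightarrow> ('x \<Rightarrow> 'g::group_add) \<Rightarrow> 'x \<times> 'g \<Rightarrow> 'x \<times> 'g" where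
  "skew T f p = (T (fst p), f (fst p) + snd p)"

definition orbit :: "('a \<Rightarrow> 'a) \<Rightarrow> 'a \<Rightarrow> 'a set" where
  "orbit S p = {(S ^^ n) p | n. True} \<union> {(inv S ^^ n) p | n. True}"

definition surj_orbit_closure :: "('x \<Rightarrow> 'x) \<Rightarrow> ('x \<Rightarrow> 'g::{group_add,topological_space})
     \<Rightarrow> ('x::topological_space \<times> 'g) set \<Rightarrow> bool" where
  "surj_orbit_closure T f C \<longleftrightarrow> (\<exists>p. C = closure (orbit (skew T f) p)) \<and> fst ` C = UNIV"

definition regular_cocycle :: "('x::topological_space \<Rightarrow> 'x) \<Rightarrow> ('x \<Rightarrow> 'g::{group_add,topological_space}) \<Rightarrow> bool" where
  "regular_cocycle T f \<longleftrightarrow> (\<exists>C. surj_orbit_closure T f C)"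

definition Rmul :: "'g::group_add \<Rightarrow> 'x \<times> 'g \<Rightarrow> 'x \<times> 'g" where
  "Rmul h p = (fst p, snd p + - h)"

definition Stab :: "('x \<times> 'g::group_add) set \<Rightarrow> 'g set" where
  "Stab C = {h. Rmul h ` C = C}"

definition lcoset :: "'g::group_add \<Rightarrow> 'g set \<Rightarrow> 'g set" where
  "lcoset g H = (\<lambda>h. g + h) ` H"

definition quot_topology :: "'g::{group_add,topological_space} set \<Rightarrow> 'g set topology" where
  "quot_topology H = topology (\<lambda>U. U \<subseteq> range (\<lambda>g. lcoset g H) \<and> open {g. lcoset g H \<in> U})"

lemma istopology_quot: "istopology (\<lambda>U. U \<subseteq> range (\<lambda>g. lcoset g (H::'g::{group_add,topological_space} set)) \<and> open {g. lcoset g H \<in> U})"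
proof -
  have i: "{g. lcoset g H \<in> S \<inter> T} = {g. lcoset g H \<in> S} \<inter> {g. lcoset g H \<in> T}" for S T by auto
  have u: "{g. lcoset g H \<in> \<Union>K} = (\<Union>U\<in>K. {g. lcoset g H \<in> U})" for K by auto
  show ?thesis unfolding istopology_def i u by auto
qed

end

theory Submission
  imports Defs
begin

text \<open>By Baire's theorem and minimality there is a compact \<open>K \<subseteq> G\<close> meeting every fibre of \<open>C\<close>. If
  \<open>(x0, g0)\<close> generates \<open>C\<close>, its fibre is \<open>g0 + S\<close> for the closed monoid \<open>S\<close> of all right translations
  mapping \<open>C\<close> into itself, and compactness makes all right ideals \<open>s + S\<close> meet a common compact set.
  A nilpotent group contains no free semigroup on two generators, so these ideals are directed and have a common
  point, which forces \<open>S\<close> to be a group; thus \<open>S = Stab C\<close>. Then \<open>C\<close> is compact modulo \<open>S\<close>, so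
  two points \<open>(x, g)\<close>, \<open>(x, g')\<close> of one fibre can be moved simultaneously towards the coset
  \<open>g0 + S\<close>. This puts \<open>- g + g'\<close> into \<open>S + W + S\<close> for every neighbourhood \<open>W\<close> of \<open>0\<close>, and
  nilpotency yields \<open>- g + g' \<in> S\<close>. Continuity is upper semicontinuity of the fibres, again by
  compactness modulo \<open>S\<close>.\<close>

lemmas group_simps = add.assoc minus_add diff_conv_add_uminus

section \<open>Lower central series\<close>

lemma lower_central_add: "a \<in> lower_central i \<Longrightarrow> b \<in> lower_central i \<Longrightarrow> a + b \<in> lower_central i"
  by (cases i) (auto intro: gen_subgroup.intros)

lemma lower_central_uminus: "a \<in> lower_central i \<Longrightarrow> - a \<in> lower_central i"
  by (cases i) (auto intro: gen_subgroup.intros)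

lemma gcomm_lower_central: "a \<in> lower_central i \<Longrightarrow> gcomm a b \<in> lower_central (Suc i)"
  by (auto intro: gen_subgroup.gen_base)

lemma gen_subgroup_mono: "A \<subseteq> B \<Longrightarrow> gen_subgroup A \<subseteq> gen_subgroup B"
proof
  fix x assume "A \<subseteq> B" "x \<in> gen_subgroup A"
  from this(2) \<open>A \<subseteq> B\<close> show "x \<in> gen_subgroup B"
    by induction (auto intro: gen_subgroup.intros)
qed

lemma lower_central_Suc_subset: "lower_central (Suc i) \<subseteq> (lower_central i :: 'g::group_add set)"
proof (induction i)
  case (Suc i)
  have "gen_subgroup {gcomm a b | a b. a \<in> (lower_central (Suc i) :: 'g set)}
      \<subseteq> gen_subgroup {gcomm a b | a b. a \<in> lower_central i}"
    using Suc by (intro gen_subgroup_mono) blast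
  then show ?case by simp
qed simp

lemma lower_central_conj:
  assumes "z \<in> lower_central i"
  shows "- h + z + h \<in> lower_central i"
proof -
  have "- h + z + h = z + gcomm z h"
    by (simp add: gcomm_def group_simps del: add_uminus_conv_diff)
  moreover have "gcomm z h \<in> lower_central i"
    using gcomm_lower_central[OF assms] lower_central_Suc_subset by blast
  ultimately show ?thesis
    using assms lower_central_add by metis
qed

text \<open>Mal'cev's semigroup words \<open>x' = x + y\<close>, \<open>y' = y + x\<close>: if \<open>y = x + c\<close> then
  \<open>y' = x' + gcomm c x\<close>, so each step pushes the discrepancy one term down the lower central series.\<close>

lemma nilpotent_Ore:
  fixes S :: "'g::group_add set"
  assumes nil: "nilpotent_group TYPE('g)"
    and zero: "0 \<in> S" and add: "\<And>a b. a \<in> S \<Longrightarrow> b \<in> S \<Longrightarrow> a + b \<in> S"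
    and "s \<in> S" "t \<in> S"
  shows "\<exists>u\<in>S. \<exists>v\<in>S. s + u = t + v"
proof -
  have "\<exists>u\<in>S. \<exists>v\<in>S. - (s + u) + (t + v) \<in> lower_central n" for n
  proof (induction n)
    case 0
    show ?case using zero by auto
  next
    case (Suc n)
    then obtain u v where uv: "u \<in> S" "v \<in> S" "- (s + u) + (t + v) \<in> lower_central n"
      by blast
    define x where "x = s + u"
    define c where "c = - x + (t + v)"
    have y: "t + v = x + c" by (simp add: c_def add.assoc[symmetric])
    have "s + (u + (t + v)) = x + (x + c)"
      unfolding y[symmetric] unfolding x_def by (simp add: group_simps del: add_uminus_conv_diff)
    moreover have "t + (v + (s + u)) = x + c + x"
      unfolding y[symmetric] unfolding x_def by (simp add: group_simps del: add_uminus_conv_diff)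
    ultimately have "- (s + (u + (t + v))) + (t + (v + (s + u))) = gcomm c x"
      by (simp add: gcomm_def group_simps del: add_uminus_conv_diff)
    moreover have "gcomm c x \<in> lower_central (Suc n)"
      using uv(3) by (intro gcomm_lower_central) (simp add: c_def x_def)
    ultimately show ?case
      using uv(1,2) \<open>s \<in> S\<close> \<open>t \<in> S\<close> add
      by (intro bexI[of _ "u + (t + v)"] bexI[of _ "v + (s + u)"]) auto
  qed
  moreover obtain n where "lower_central n = ({0} :: 'g set)"
    using nil unfolding nilpotent_group_def by blast
  ultimately obtain u v where "u \<in> S" "v \<in> S" "- (s + u) + (t + v) = 0"
    by (metis singletonD)
  then show ?thesis
    by (metis add.right_inverse add_left_cancel left_minus)
qed


section \<open>Topological groups\<close>

text \<open>If the slice over \<open>x\<close> misses \<open>A\<close>, the tube lemma extends this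
  to a neighbourhood of \<open>x\<close>. Conditions asking for some \<open>k\<close> in
  \<open>K\<close> thereby become closed and pass from an orbit to its closure.\<close>

lemma closed_compact_projection:
  fixes A :: "('a::topological_space \<times> 'b::topological_space) set"
  assumes "closed A" "compact K"
  shows "closed {x. \<exists>k\<in>K. (x, k) \<in> A}"
proof -
  have "open {x. \<forall>k\<in>K. (x, k) \<notin> A}"
  proof (subst open_subopen, safe)
    fix x assume x: "\<forall>k\<in>K. (x, k) \<notin> A"
    have "open (- A)" using assms(1) by auto
    then have "openin (prod_topology euclidean euclidean) (- A)"
      by simp
    moreover have "{x} \<times> K \<subseteq> - A" using x by auto
    ultimately obtain U V where "open U" "x \<in> U" "K \<subseteq> V" "U \<times> V \<subseteq> - A"
      using tube_lemma_right[of euclidean euclidean "- A" K x] assms(2) by auto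
    then show "\<exists>T. open T \<and> x \<in> T \<and> T \<subseteq> {x. \<forall>k\<in>K. (x, k) \<notin> A}"
      by blast
  qed
  then show ?thesis
    by (simp add: closed_def Collect_neg_eq[symmetric])
qed

text \<open>Modulo \<open>lower_central (Suc i)\<close> the elements of
  \<open>lower_central i\<close> are central, so \<open>h1 + z\<close> conjugates \<open>H\<close>
  as \<open>h1\<close> does; continuity extends this to the closure.\<close>

lemma normalizer_mod_lower_central:
  fixes H :: "'g::topological_group_add set"
  assumes H: "0 \<in> H" "\<And>a b. a \<in> H \<Longrightarrow> b \<in> H \<Longrightarrow> a + b \<in> H" "\<And>a. a \<in> H \<Longrightarrow> - a \<in> H"
    and w: "w \<in> closure {h + z | h z. h \<in> H \<and> z \<in> lower_central i}" and h: "h \<in> H"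
  shows "- w + h + w \<in> closure {h + z | h z. h \<in> H \<and> z \<in> lower_central (Suc i)}"
    (is "_ \<in> closure ?Q")
proof -
  have "(\<lambda>w. - w + h + w) ` closure {h + z | h z. h \<in> H \<and> z \<in> lower_central i} \<subseteq> closure ?Q"
  proof (rule image_closure_subset)
    show "continuous_on (closure {h + z | h z. h \<in> H \<and> z \<in> lower_central i}) (\<lambda>w. - w + h + w)"
      by (intro continuous_intros)
    show "(\<lambda>w. - w + h + w) ` {h + z | h z. h \<in> H \<and> z \<in> lower_central i} \<subseteq> closure ?Q"
    proof clarify
      fix h1 z :: 'g assume h1: "h1 \<in> H" and z: "z \<in> lower_central i"
      let ?k = "- h1 + h + h1"
      have "- (h1 + z) + h + (h1 + z) = ?k + - gcomm z ?k"
        by (simp add: gcomm_def group_simps del: add_uminus_conv_diff)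
      moreover have "?k \<in> H" using H h h1 by auto
      moreover have "- gcomm z ?k \<in> lower_central (Suc i)"
        by (intro lower_central_uminus gcomm_lower_central z)
      ultimately have "- (h1 + z) + h + (h1 + z) \<in> ?Q" by blast
      then show "- (h1 + z) + h + (h1 + z) \<in> closure ?Q"
        by (rule subsetD[OF closure_subset])
    qed
  qed simp
  with w show ?thesis by blast
qed

text \<open>For a normal subgroup this is trivial. In general \<open>t\<close> is moved down the chain
  \<open>closure (H + lower_central i)\<close>, each term of which normalizes the next one.\<close>

lemma nilpotent_double_coset_limit:
  fixes H :: "'g::topological_group_add set"
  assumes nil: "nilpotent_group TYPE('g)"
    and H: "closed H" "0 \<in> H" "\<And>a b. a \<in> H \<Longrightarrow> b \<in> H \<Longrightarrow> a + b \<in> H" "\<And>a. a \<in> H \<Longrightarrow> - a \<in> H"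
    and t: "\<And>W. open W \<Longrightarrow> 0 \<in> W \<Longrightarrow> \<exists>h\<in>H. \<exists>w\<in>W. \<exists>h'\<in>H. t = h + w + h'"
  shows "t \<in> H"
proof -
  define Q where "Q i = {h + z | h z. h \<in> H \<and> z \<in> lower_central i}" for i
  have Q_add_H: "a + h \<in> closure (Q i)" if "a \<in> closure (Q i)" "h \<in> H" for a h i
  proof -
    have "(\<lambda>a. a + h) ` closure (Q i) \<subseteq> closure (Q i)"
    proof (rule image_closure_subset)
      show "(\<lambda>a. a + h) ` Q i \<subseteq> closure (Q i)"
      proof clarify
        fix a assume "a \<in> Q i"
        then obtain h1 z where a: "a = h1 + z" and h1: "h1 \<in> H" and z: "z \<in> lower_central i"
          unfolding Q_def by blast
        have "a + h = (h1 + h) + (- h + z + h)"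
          by (simp add: a group_simps del: add_uminus_conv_diff)
        then have "a + h \<in> Q i"
          unfolding Q_def using H(3)[OF h1 \<open>h \<in> H\<close>] lower_central_conj[OF z] by blast
        then show "a + h \<in> closure (Q i)" by (rule subsetD[OF closure_subset])
      qed
    qed (auto intro!: continuous_intros)
    with that show ?thesis by blast
  qed
  have H_add_Q: "h + a \<in> closure (Q i)" if "a \<in> closure (Q i)" "h \<in> H" for a h i
  proof -
    have "(\<lambda>a. h + a) ` closure (Q i) \<subseteq> closure (Q i)"
    proof (rule image_closure_subset)
      show "(\<lambda>a. h + a) ` Q i \<subseteq> closure (Q i)"
        using closure_subset[of "Q i"] H(3)[OF \<open>h \<in> H\<close>] unfolding Q_def
        by (fastforce simp: add.assoc[symmetric])
    qed (auto intro!: continuous_intros)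
    with that show ?thesis by blast
  qed
  have tQ: "t \<in> closure (Q i)" for i
  proof (induction i)
    case 0
    have "Q 0 = UNIV" unfolding Q_def using H(2) by (auto intro: exI[of _ 0])
    then show ?case by simp
  next
    case (Suc i)
    \<comment> \<open>The \<open>- 0\<close> presents \<open>t\<close> as the value at
      \<open>w = 0\<close> of the map sending \<open>w\<close> to \<open>- w + t\<close>; the
      hypothesis is applied to a neighbourhood of \<open>0\<close> on which this map misses the
      closure.\<close>
    have "- 0 + t \<in> closure (Q (Suc i))"
    proof (rule ccontr)
      assume "- 0 + t \<notin> closure (Q (Suc i))"
      moreover have "open ((\<lambda>w. - w + t) -` (- closure (Q (Suc i))))"
        by (intro open_vimage continuous_intros) auto
      ultimately obtain h w h' where hw: "h \<in> H" "h' \<in> H" "t = h + w + h'"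
        and w: "- w + t \<notin> closure (Q (Suc i))"
        using t[of "(\<lambda>w. - w + t) -` (- closure (Q (Suc i)))"] by auto
      \<comment> \<open>\<open>w\<close> differs from \<open>t\<close> only by summands from
        \<open>H\<close> on both sides, so it inherits membership in \<open>closure (Q i)\<close>
        and the normalizing lemma applies to it.\<close>
      have "w = - h + t + - h'"
        by (simp add: hw(3) group_simps del: add_uminus_conv_diff)
      then have "w \<in> closure (Q i)"
        using Q_add_H H_add_Q Suc H(4) hw(1,2) by metis
      then have "- w + h + w \<in> closure (Q (Suc i))"
        unfolding Q_def using H hw(1) by (intro normalizer_mod_lower_central) auto
      then have "- w + h + w + h' \<in> closure (Q (Suc i))"
        using Q_add_H hw(2) by blast
      with w show False by (simp add: hw(3) group_simps del: add_uminus_conv_diff)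
    qed
    then show ?case by simp
  qed
  obtain n where "lower_central n = ({0} :: 'g set)"
    using nil unfolding nilpotent_group_def by blast
  then have "Q n = H" unfolding Q_def by auto
  with tQ[of n] H(1) show ?thesis by simp
qed

text \<open>The right ideals \<open>s + S\<close> are directed downwards by the Ore condition. Hence they have
  a common point \<open>k\<close> in \<open>K\<close>, and \<open>k \<in> k + k + S\<close> makes \<open>k\<close>, then every \<open>s\<close>, invertible in \<open>S\<close>.\<close>

lemma nilpotent_semigroup_is_group:
  fixes S :: "'g::topological_group_add set"
  assumes nil: "nilpotent_group TYPE('g)" and "closed S" "compact K"
    and zero: "0 \<in> S" and add: "\<And>a b. a \<in> S \<Longrightarrow> b \<in> S \<Longrightarrow> a + b \<in> S"
    and meets: "\<And>s. s \<in> S \<Longrightarrow> \<exists>s'\<in>S. s + s' \<in> K"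
    and "s \<in> S"
  shows "- s \<in> S"
proof -
  define I where "I s = {a. - s + a \<in> S}" for s
  have directed: "\<exists>u\<in>S. u \<in> \<Inter>(I ` F)" if "finite F" "F \<subseteq> S" for F
    using that
  proof (induction F)
    case empty
    then show ?case using zero by auto
  next
    case (insert t F)
    then obtain u where u: "u \<in> S" "\<forall>s\<in>F. - s + u \<in> S" unfolding I_def by auto
    \<comment> \<open>A common right multiple of \<open>u\<close> and the new \<open>t\<close>;
      adding \<open>v\<close> on the right keeps \<open>u\<close> inside the earlier ideals.\<close>
    obtain v v' where v: "v \<in> S" "v' \<in> S" "u + v = t + v'"
      using nilpotent_Ore[OF nil zero add u(1), of t] insert.prems by auto
    have "- s + (u + v) \<in> S" if "s \<in> F" for s
      using add[of "- s + u" v] u(2) v(1) that by (simp add: group_simps del: add_uminus_conv_diff)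
    moreover have "- t + (u + v) \<in> S" by (simp add: v)
    moreover have "u + v \<in> S" using add u(1) v(1) .
    ultimately show ?case unfolding I_def by auto
  qed
  have "K \<inter> \<Inter>(I ` S) \<noteq> {}"
  proof (rule compact_imp_fip_image)
    show "closed (I s)" for s
      using closed_vimage[OF \<open>closed S\<close>, of "\<lambda>a. - s + a"]
      by (simp add: I_def vimage_def continuous_intros)
    show "K \<inter> \<Inter>(I ` F) \<noteq> {}" if F: "finite F" "F \<subseteq> S" for F
    proof -
      obtain u where u: "u \<in> S" "\<forall>s\<in>F. - s + u \<in> S"
        using directed[OF F] unfolding I_def by auto
      \<comment> \<open>\<open>u\<close> may lie outside \<open>K\<close>; a right summand from
        \<open>S\<close> reaches \<open>K\<close> without leaving the ideals.\<close>
      obtain s' where s': "s' \<in> S" "u + s' \<in> K" using meets u by blast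
      have "- s + (u + s') \<in> S" if "s \<in> F" for s
        using add[of "- s + u" s'] u(2) s'(1) that by (simp add: group_simps del: add_uminus_conv_diff)
      with s' show ?thesis unfolding I_def by auto
    qed
  qed (fact \<open>compact K\<close>)
  then obtain k where k: "- s + k \<in> S" if "s \<in> S" for s unfolding I_def by auto
  have "k \<in> S" using k[OF zero] by simp
  then have "- (k + k) + k \<in> S" by (intro k add)
  then have "- k \<in> S" by (simp add: group_simps del: add_uminus_conv_diff)
  with add[OF k[OF \<open>s \<in> S\<close>]] show ?thesis by (fastforce simp: group_simps simp del: add_uminus_conv_diff)
qed

section \<open>Countable compact covers and Baire category\<close>

lemma locally_compact_countable_compact_cover:
  assumes "locally_compact_space (euclidean :: 'g::second_countable_topology topology)"
  obtains \<K> :: "'g::second_countable_topology set set" where "countable \<K>" "\<And>K. K \<in> \<K> \<Longrightarrow> compact K" "\<Union>\<K> = UNIV"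
proof -
  obtain B :: "'g set set" where B: "countable B" "topological_basis B"
    using ex_countable_basis by blast
  define B' where "B' = {U \<in> B. \<exists>K. compact K \<and> U \<subseteq> K}"
  have "\<forall>U\<in>B'. \<exists>K. compact K \<and> U \<subseteq> K" unfolding B'_def by blast
  then obtain k where k: "\<And>U. U \<in> B' \<Longrightarrow> compact (k U) \<and> U \<subseteq> k U"
    by (auto dest!: bchoice)
  have "\<exists>U\<in>B'. g \<in> U" for g
  proof -
    obtain U K where "open U" "compact K" "g \<in> U" "U \<subseteq> K"
      using assms unfolding locally_compact_space_def by simp blast
    moreover then obtain V where "V \<in> B" "g \<in> V" "V \<subseteq> U"
      using B(2) topological_basisE by blast
    ultimately show ?thesis unfolding B'_def by blast
  qed
  then have "\<Union>(k ` B') = UNIV" using k by blast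
  moreover have "countable (k ` B')" using B(1) unfolding B'_def by auto
  ultimately show ?thesis using that k by blast
qed

lemma compact_metric_Baire:
  fixes \<A> :: "'x::metric_space set set"
  assumes "compact (UNIV :: 'x set)" "countable \<A>" "\<And>A. A \<in> \<A> \<Longrightarrow> closed A" "\<Union>\<A> = UNIV"
  shows "\<exists>A\<in>\<A>. interior A \<noteq> {}"
proof -
  have "locally_compact_space (euclidean :: 'x topology)"
    using assms(1) by (intro compact_imp_locally_compact_space) (simp add: compact_space_def)
  moreover have "regular_space (euclidean :: 'x topology)"
    by (intro metrizable_imp_regular_space metrizable_space_euclidean)
  ultimately have "euclidean interior_of \<Union>\<A> = {}" if "\<And>A. A \<in> \<A> \<Longrightarrow> interior A = {}"
    using that assms(2,3) by (intro Baire_category_alt) auto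
  with assms(4) show ?thesis by auto
qed

section \<open>Orbit closures of cocycles\<close>

text \<open>Time enters only through the action and cocycle identities, so it may be any group
  \<open>'i\<close>; \<open>int\<close> is substituted at the end. Minimality takes the form that
  every orbit is dense.\<close>

locale surjective_cocycle_orbit_closure =
  fixes \<tau> :: "'i::group_add \<Rightarrow> 'x::metric_space \<Rightarrow> 'x"
    and \<phi> :: "'i \<Rightarrow> 'x \<Rightarrow> 'g::{topological_group_add, second_countable_topology}"
    and x0 :: 'x and g0 :: 'g and C :: "('x \<times> 'g) set"
  assumes \<tau>_zero: "\<tau> 0 x = x"
    and \<tau>_add: "\<tau> (m + n) x = \<tau> m (\<tau> n x)"
    and \<phi>_add: "\<phi> (m + n) x = \<phi> m (\<tau> n x) + \<phi> n x"
    and cont_\<tau>: "continuous_on UNIV (\<tau> n)"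
    and cont_\<phi>: "continuous_on UNIV (\<phi> n)"
    and compact_base: "compact (UNIV :: 'x set)"
    and minimal: "open U \<Longrightarrow> U \<noteq> {} \<Longrightarrow> \<exists>n. \<tau> n x \<in> U"
    and loc_compact: "locally_compact_space (euclidean :: 'g topology)"
    and nilpotent: "nilpotent_group TYPE('g)"
    and C_closure: "C = closure (range (\<lambda>n. (\<tau> n x0, \<phi> n x0 + g0)))"
    and surjective: "\<exists>g. (x, g) \<in> C"
begin

lemma \<phi>_zero: "\<phi> 0 x = 0"
proof -
  have "\<phi> 0 x + \<phi> 0 x = \<phi> 0 x + 0"
    using \<phi>_add[of 0 0 x] by (simp add: \<tau>_zero)
  then show ?thesis by (simp only: add_left_cancel)
qed

lemma \<tau>_uminus: "\<tau> (- n) (\<tau> n x) = x"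
  by (metis \<tau>_add \<tau>_zero left_minus)

lemma \<phi>_uminus: "\<phi> (- n) (\<tau> n x) = - \<phi> n x"
  by (metis \<phi>_add \<phi>_zero left_minus eq_neg_iff_add_eq_0)

lemma closed_C: "closed C"
  by (simp add: C_closure)

lemma orbit_in_C: "(\<tau> n x0, \<phi> n x0 + g0) \<in> C"
  unfolding C_closure by (rule subsetD[OF closure_subset]) blast

lemma base_in_C: "(x0, g0) \<in> C"
  using orbit_in_C[of 0] by (simp add: \<tau>_zero \<phi>_zero)

lemma C_subset_closed:
  assumes "closed D" "\<And>n. (\<tau> n x0, \<phi> n x0 + g0) \<in> D"
  shows "C \<subseteq> D"
  unfolding C_closure by (intro closure_minimal assms(1)) (use assms(2) in auto)

lemma C_invariant:
  assumes "(x, g) \<in> C"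
  shows "(\<tau> n x, \<phi> n x + g) \<in> C"
proof -
  let ?D = "(\<lambda>p. (\<tau> n (fst p), \<phi> n (fst p) + snd p)) -` C"
  have "closed ?D"
    by (intro closed_vimage closed_C continuous_intros
        continuous_on_compose2[OF cont_\<tau>] continuous_on_compose2[OF cont_\<phi>]) auto
  moreover have "(\<tau> m x0, \<phi> m x0 + g0) \<in> ?D" for m
    using orbit_in_C[of "n + m"] by (simp add: \<tau>_add \<phi>_add add.assoc)
  ultimately have "C \<subseteq> ?D" by (rule C_subset_closed)
  from subsetD[OF this assms] show ?thesis by simp
qed

section \<open>The monoid of right translations mapping \<open>C\<close> into itself\<close>

definition S :: "'g set" where
  "S = {s. \<forall>(x, g)\<in>C. (x, g + s) \<in> C}"

lemma S_translate: "s \<in> S \<Longrightarrow> (x, g) \<in> C \<Longrightarrow> (x, g + s) \<in> C"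
  by (auto simp: S_def)

lemma S_zero: "0 \<in> S"
  by (auto simp: S_def)

lemma S_add: "a \<in> S \<Longrightarrow> b \<in> S \<Longrightarrow> a + b \<in> S"
  unfolding S_def by (auto simp: add.assoc[symmetric])

lemma closed_S: "closed S"
proof -
  have "S = (\<Inter>p\<in>C. (\<lambda>s. (fst p, snd p + s)) -` C)"
    by (auto simp: S_def)
  also have "closed \<dots>"
    by (intro closed_INT ballI closed_vimage closed_C continuous_intros)
  finally show ?thesis .
qed

text \<open>Right translations commute with the skew product. If the translate of the generating
  point lies in \<open>C\<close>, so does that of its orbit and, \<open>C\<close> being closed, that
  of all of \<open>C\<close>. Thus \<open>g0 + S\<close> is the fibre over
  \<open>x0\<close>.\<close>

lemma S_iff: "s \<in> S \<longleftrightarrow> (x0, g0 + s) \<in> C"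
proof
  assume s: "(x0, g0 + s) \<in> C"
  let ?D = "(\<lambda>p. (fst p, snd p + s)) -` C"
  have "closed ?D"
    by (intro closed_vimage closed_C continuous_intros)
  moreover have "(\<tau> n x0, \<phi> n x0 + g0) \<in> ?D" for n
    using C_invariant[OF s, of n] by (simp add: group_simps del: add_uminus_conv_diff)
  ultimately have "C \<subseteq> ?D" by (rule C_subset_closed)
  then show "s \<in> S" by (auto simp: S_def)
qed (use base_in_C S_translate in blast)

text \<open>Invariance of \<open>C\<close> transports the description of the fibre over
  \<open>x0\<close> along the orbit.\<close>

lemma S_orbit_iff: "- (\<phi> n x0 + g0) + g \<in> S \<longleftrightarrow> (\<tau> n x0, g) \<in> C"
proof -
  have "- (\<phi> n x0 + g0) + g \<in> S \<longleftrightarrow> (x0, - \<phi> n x0 + g) \<in> C"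
    by (simp add: S_iff group_simps del: add_uminus_conv_diff)
  also have "\<dots> \<longleftrightarrow> (\<tau> n x0, g) \<in> C"
    using C_invariant[of x0 "- \<phi> n x0 + g" n] C_invariant[of "\<tau> n x0" g "- n"]
    by (auto simp: \<tau>_uminus \<phi>_uminus group_simps simp del: add_uminus_conv_diff)
  finally show ?thesis .
qed

section \<open>Compactness of \<open>C\<close> modulo \<open>S\<close>\<close>

lemma compact_section: "\<exists>K. compact K \<and> (\<forall>x. \<exists>k\<in>K. (x, k) \<in> C)"
proof -
  obtain \<K> :: "'g set set" where \<K>: "countable \<K>" "\<And>K. K \<in> \<K> \<Longrightarrow> compact K" "\<Union>\<K> = UNIV"
    using locally_compact_countable_compact_cover[OF loc_compact] by blast
  define A where "A K = {x. \<exists>k\<in>K. (x, k) \<in> C}" for K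
  have "\<Union>(A ` \<K>) = UNIV"
    unfolding A_def using \<K>(3) surjective by (auto, metis UNIV_I UnionE)
  moreover have "closed (A K)" if "K \<in> \<K>" for K
    unfolding A_def using closed_C \<K>(2)[OF that] by (rule closed_compact_projection)
  ultimately have "\<exists>Z\<in>A ` \<K>. interior Z \<noteq> {}"
    using \<K>(1) by (intro compact_metric_Baire[OF compact_base]) auto
  then obtain K where K: "K \<in> \<K>" "interior (A K) \<noteq> {}" by blast
  \<comment> \<open>By minimality and compactness, finitely many times suffice to bring every point
    into the interior of \<open>A K\<close>.\<close>
  have "open (\<tau> n -` interior (A K))" for n
    by (intro open_vimage cont_\<tau>) auto
  moreover have "UNIV \<subseteq> (\<Union>n. \<tau> n -` interior (A K))"
    using minimal[OF open_interior K(2)] by auto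
  ultimately obtain F where F: "finite F" "UNIV \<subseteq> (\<Union>n\<in>F. \<tau> n -` interior (A K))"
    using compactE_image[OF compact_base, of UNIV "\<lambda>n. \<tau> n -` interior (A K)"] by auto
  \<comment> \<open>A point of \<open>K\<close> over \<open>\<tau> n x\<close> is pulled back to the
    fibre over \<open>x\<close> by adding \<open>- \<phi> n x\<close> on the left;
    \<open>L n\<close> contains all the results.\<close>
  define L where "L n = (\<lambda>p. - \<phi> n (fst p) + snd p) ` (UNIV \<times> K)" for n
  have "compact (L n)" for n
    unfolding L_def
    by (intro compact_continuous_image compact_Times compact_base \<K>(2) K(1) continuous_intros
        continuous_on_compose2[OF cont_\<phi>]) auto
  then have "compact (\<Union>n\<in>F. L n)" using F(1) by blast
  moreover have "\<exists>k\<in>(\<Union>n\<in>F. L n). (x, k) \<in> C" for x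
  proof -
    obtain n where n: "n \<in> F" "\<tau> n x \<in> A K" using F(2) interior_subset by blast
    then obtain k where k: "k \<in> K" "(\<tau> n x, k) \<in> C" unfolding A_def by blast
    have "(x, - \<phi> n x + k) \<in> C"
      using C_invariant[OF k(2), of "- n"] by (simp add: \<tau>_uminus \<phi>_uminus)
    moreover have "- \<phi> n x + k \<in> L n" unfolding L_def using k(1) by force
    ultimately show ?thesis using n(1) by blast
  qed
  ultimately show ?thesis by blast
qed

lemma S_uminus:
  assumes "s \<in> S"
  shows "- s \<in> S"
proof -
  obtain K where K: "compact K" "\<And>x. \<exists>k\<in>K. (x, k) \<in> C" using compact_section by blast
  show ?thesis
  proof (rule nilpotent_semigroup_is_group[OF nilpotent closed_S _ S_zero S_add _ assms])
    show "compact ((\<lambda>k. - g0 + k) ` K)"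
      by (intro compact_continuous_image K(1) continuous_intros)
    fix s assume s: "s \<in> S"
    \<comment> \<open>On the orbit, \<open>- a + k \<in> S\<close> is solvable in \<open>K\<close>
      because \<open>K\<close> meets every fibre. Solvability is a closed condition, so it extends
      to \<open>C\<close> and in particular to \<open>(x0, g0 + s)\<close>.\<close>
    have "closed {a. \<exists>k\<in>K. (a, k) \<in> (\<lambda>p. - fst p + snd p) -` S}"
      by (intro closed_compact_projection K(1) closed_vimage closed_S continuous_intros)
    then have "closed (snd -` {a. \<exists>k\<in>K. - a + k \<in> S} :: ('x \<times> 'g) set)"
      by (intro closed_vimage continuous_intros) simp
    then have "C \<subseteq> snd -` {a. \<exists>k\<in>K. - a + k \<in> S}"
      by (rule C_subset_closed) (use K(2) in \<open>simp add: S_orbit_iff\<close>)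
    moreover have "(x0, g0 + s) \<in> C" using s S_iff by blast
    ultimately obtain k where k: "k \<in> K" "- (g0 + s) + k \<in> S" by auto
    have "s + (- (g0 + s) + k) = - g0 + k" by (simp add: group_simps del: add_uminus_conv_diff)
    with k show "\<exists>s'\<in>S. s + s' \<in> (\<lambda>k. - g0 + k) ` K" by (metis image_eqI)
  qed
qed

text \<open>By \<open>S_uminus\<close>, a translation mapping \<open>C\<close> into itself has an
  inverse doing the same, so it maps \<open>C\<close> onto itself. As \<open>Rmul h\<close> adds
  \<open>- h\<close>, the sign also needs \<open>S_uminus\<close>.\<close>

lemma Stab_C: "Stab C = S"
proof -
  have "h \<in> S" if "Rmul h ` C = C" for h
  proof -
    have "- h \<in> S" unfolding S_def using that by (force simp: Rmul_def)
    then show ?thesis using S_uminus by fastforce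
  qed
  moreover have "Rmul h ` C = C" if h: "h \<in> S" for h
  proof -
    have "Rmul h p \<in> C" "Rmul (- h) p \<in> C" "Rmul h (Rmul (- h) p) = p" if "p \<in> C" for p
      using S_translate[OF S_uminus[OF h]] S_translate[OF h] that
      by (cases p; auto simp: Rmul_def group_simps simp del: add_uminus_conv_diff)+
    then show ?thesis by (auto, metis image_eqI)
  qed
  ultimately show ?thesis unfolding Stab_def by blast
qed

text \<open>Over the orbit, \<open>S_orbit_iff\<close> turns a point of the compact section into the
  required \<open>k\<close>; the condition is closed and extends to \<open>C\<close>.\<close>

lemma compact_transversal: "\<exists>K. compact K \<and> (\<forall>x g. (x, g) \<in> C \<longrightarrow> (\<exists>k\<in>K. - g + k \<in> S))"
proof -
  obtain K where K: "compact K" "\<And>x. \<exists>k\<in>K. (x, k) \<in> C" using compact_section by blast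
  have "closed {p. \<exists>k\<in>K. (p, k) \<in> (\<lambda>(p :: 'x \<times> 'g, k). - snd p + k) -` S}"
    unfolding case_prod_unfold
    by (intro closed_compact_projection K(1) closed_vimage closed_S continuous_intros)
  then have "C \<subseteq> {p. \<exists>k\<in>K. (p, k) \<in> (\<lambda>(p, k). - snd p + k) -` S}"
    by (rule C_subset_closed) (use K(2) in \<open>simp add: S_orbit_iff\<close>)
  from subsetD[OF this] have "\<exists>k\<in>K. - g + k \<in> S" if "(x, g) \<in> C" for x g
    using that by fastforce
  with K(1) show ?thesis by blast
qed

text \<open>As \<open>V\<close> is right \<open>S\<close>-invariant, a fibre leaves \<open>V\<close>
  only if it does so at a point of the compact transversal, which is a closed condition on
  \<open>x\<close>. This is upper semicontinuity of the fibres.\<close>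

lemma open_fibre_subset:
  assumes "open V" and sat: "\<And>g s. g \<in> V \<Longrightarrow> s \<in> S \<Longrightarrow> g + s \<in> V"
  shows "open {x. \<forall>g. (x, g) \<in> C \<longrightarrow> g \<in> V}"
proof -
  obtain K where K: "compact K" "\<And>x g. (x, g) \<in> C \<Longrightarrow> \<exists>k\<in>K. - g + k \<in> S"
    using compact_transversal by blast
  have "compact (K \<inter> - V)" using K(1) assms(1) by (intro compact_Int_closed) auto
  then have "open (- {x. \<exists>k\<in>K \<inter> - V. (x, k) \<in> C})" unfolding open_closed double_complement
    by (intro closed_compact_projection closed_C)
  moreover have "- {x. \<exists>k\<in>K \<inter> - V. (x, k) \<in> C} = {x. \<forall>g. (x, g) \<in> C \<longrightarrow> g \<in> V}"
  proof (intro equalityI subsetI CollectI allI impI)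
    fix x g assume x: "x \<in> - {x. \<exists>k\<in>K \<inter> - V. (x, k) \<in> C}" and g: "(x, g) \<in> C"
    obtain k where k: "k \<in> K" "- g + k \<in> S" using K(2)[OF g] by blast
    have "(x, k) \<in> C" using S_translate[OF k(2) g] by (simp add: group_simps del: add_uminus_conv_diff)
    with x k(1) have "k \<in> V" by blast
    from sat[OF this S_uminus[OF k(2)]] show "g \<in> V"
      by (simp add: group_simps del: add_uminus_conv_diff)
  qed auto
  ultimately show ?thesis by simp
qed

section \<open>Fibres as cosets and their continuity\<close>

lemma fibre_difference:
  assumes "(x, g) \<in> C" "(x, g') \<in> C"
  shows "- g + g' \<in> S"
proof (rule nilpotent_double_coset_limit[OF nilpotent closed_S S_zero S_add S_uminus])
  fix W :: "'g set" assume W: "open W" "0 \<in> W"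
  have "open ((\<lambda>p. - fst p + snd p :: 'g) -` W)"
    by (intro open_vimage W(1) continuous_intros)
  moreover have "(0, 0) \<in> (\<lambda>p. - fst p + snd p :: 'g) -` W" using W(2) by simp
  ultimately obtain U1 U2 where U: "open U1" "open U2" "0 \<in> U1" "0 \<in> U2"
    "U1 \<times> U2 \<subseteq> (\<lambda>p. - fst p + snd p :: 'g) -` W"
    by (elim open_prod_elim) auto
  \<comment> \<open>\<open>V\<close> will be the right \<open>S\<close>-invariant open set
    \<open>g0 + U + S\<close> around the fibre over \<open>x0\<close>. Since \<open>U\<close> lies
    in both \<open>U1\<close> and \<open>U2\<close>, all \<open>u\<close>, \<open>u'\<close> in
    \<open>U\<close> satisfy \<open>- u + u' \<in> W\<close>.\<close>
  define U where "U = U1 \<inter> U2"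
  define V where "V = (\<Union>s\<in>S. (\<lambda>a. - g0 + a + - s) -` U)"
  have "open V" unfolding V_def U_def using U(1,2)
    by (intro open_UN ballI open_vimage open_Int continuous_intros)
  have V_iff: "a \<in> V \<longleftrightarrow> (\<exists>u\<in>U. \<exists>s\<in>S. a = g0 + u + s)" for a
  proof
    assume "a \<in> V"
    then obtain s where "s \<in> S" "- g0 + a + - s \<in> U" unfolding V_def by blast
    moreover have "a = g0 + (- g0 + a + - s) + s"
      by (simp add: group_simps del: add_uminus_conv_diff)
    ultimately show "\<exists>u\<in>U. \<exists>s\<in>S. a = g0 + u + s" by blast
  next
    assume "\<exists>u\<in>U. \<exists>s\<in>S. a = g0 + u + s"
    then obtain u s where us: "u \<in> U" "s \<in> S" "a = g0 + u + s" by blast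
    have "- g0 + a + - s = u"
      unfolding us(3) by (simp add: group_simps del: add_uminus_conv_diff)
    with us(1,2) show "a \<in> V" unfolding V_def by blast
  qed
  have "open {y. \<forall>a. (y, a) \<in> C \<longrightarrow> a \<in> V}"
  proof (rule open_fibre_subset[OF \<open>open V\<close>])
    fix a s assume "a \<in> V" "s \<in> S"
    then obtain u s' where "u \<in> U" "s' \<in> S" "a = g0 + u + s'" unfolding V_iff by blast
    moreover from this \<open>s \<in> S\<close> have "s' + s \<in> S" by (intro S_add)
    ultimately show "a + s \<in> V" unfolding V_iff by (metis add.assoc)
  qed
  moreover have "a \<in> V" if "(x0, a) \<in> C" for a
  proof -
    have "- g0 + a \<in> S" using that by (simp add: S_iff group_simps del: add_uminus_conv_diff)
    moreover have "a = g0 + 0 + (- g0 + a)" by (simp add: group_simps del: add_uminus_conv_diff)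
    moreover have "0 \<in> U" using U by (simp add: U_def)
    ultimately show ?thesis unfolding V_iff by blast
  qed
  \<comment> \<open>Minimality finds a time at which the whole fibre lies in \<open>V\<close>, so
    both given points land there together.\<close>
  ultimately obtain n where n: "\<And>a. (\<tau> n x, a) \<in> C \<Longrightarrow> a \<in> V"
    using minimal[of "{y. \<forall>a. (y, a) \<in> C \<longrightarrow> a \<in> V}" x] by blast
  obtain u s where us: "u \<in> U" "s \<in> S" "\<phi> n x + g = g0 + u + s"
    using n[OF C_invariant[OF assms(1)]] unfolding V_iff by blast
  obtain u' s' where us': "u' \<in> U" "s' \<in> S" "\<phi> n x + g' = g0 + u' + s'"
    using n[OF C_invariant[OF assms(2)]] unfolding V_iff by blast
  \<comment> \<open>The same left summand \<open>\<phi> n x\<close> moves both points and cancels in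
    the difference, as does \<open>g0\<close>.\<close>
  have "- g + g' = - (\<phi> n x + g) + (\<phi> n x + g')"
    by (simp add: group_simps del: add_uminus_conv_diff)
  also have "\<dots> = - s + (- u + u') + s'"
    unfolding us(3) us'(3) by (simp add: group_simps del: add_uminus_conv_diff)
  finally have "- g + g' = - s + (- u + u') + s'" .
  moreover have "- u + u' \<in> W" using U(5) us(1) us'(1) unfolding U_def by auto
  ultimately show "\<exists>h\<in>S. \<exists>w\<in>W. \<exists>h'\<in>S. - g + g' = h + w + h'"
    using S_uminus[OF us(2)] us'(2) by blast
qed

lemma fibre_coset:
  assumes "(x, g) \<in> C"
  shows "{g. (x, g) \<in> C} = lcoset g (Stab C)"
proof -
  have "a \<in> (\<lambda>h. g + h) ` S" if "(x, a) \<in> C" for a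
    using fibre_difference[OF assms that] by (intro image_eqI[of _ _ "- g + a"]) (simp_all add: group_simps del: add_uminus_conv_diff)
  then show ?thesis
    unfolding Stab_C lcoset_def using S_translate assms by auto
qed

lemma lcoset_add: "s \<in> S \<Longrightarrow> lcoset (g + s) (Stab C) = lcoset g (Stab C)"
proof -
  have "lcoset (g + s) S \<subseteq> lcoset g S" if "s \<in> S" for g s
    unfolding lcoset_def using S_add[OF that] by (auto simp: group_simps simp del: add_uminus_conv_diff)
  from this[of s g] this[of "- s" "g + s"] show "s \<in> S \<Longrightarrow> ?thesis"
    unfolding Stab_C using S_uminus by (auto simp: group_simps simp del: add_uminus_conv_diff)
qed

text \<open>An open set of cosets pulls back to a right \<open>S\<close>-invariant open subset of
  \<open>G\<close>. A fibre, being one coset, belongs to the former exactly when it is contained in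
  the latter, so \<open>open_fibre_subset\<close> applies.\<close>

lemma continuous_fibre: "continuous_map euclidean (quot_topology (Stab C)) (\<lambda>x. {g. (x, g) \<in> C})"
proof -
  let ?H = "Stab C"
  have openin_iff: "openin (quot_topology ?H) U \<longleftrightarrow>
      U \<subseteq> range (\<lambda>g. lcoset g ?H) \<and> open {g. lcoset g ?H \<in> U}" for U
    unfolding quot_topology_def by (subst topology_inverse'[OF istopology_quot]) (rule refl)
  have "openin (quot_topology ?H) (range (\<lambda>g. lcoset g ?H))"
    unfolding openin_iff by simp
  then have "topspace (quot_topology ?H) = range (\<lambda>g. lcoset g ?H)"
    unfolding topspace_def openin_iff by auto
  then have "{g. (x, g) \<in> C} \<in> topspace (quot_topology ?H)" for x
    using surjective[of x] fibre_coset by blast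
  moreover have "open {x. {g. (x, g) \<in> C} \<in> U}" if U: "openin (quot_topology ?H) U" for U
  proof -
    have "open {g. lcoset g ?H \<in> U}" using U openin_iff by blast
    then have "open {x. \<forall>g. (x, g) \<in> C \<longrightarrow> g \<in> {g. lcoset g ?H \<in> U}}"
      by (rule open_fibre_subset) (simp add: lcoset_add)
    moreover have "{x. \<forall>g. (x, g) \<in> C \<longrightarrow> g \<in> {g. lcoset g ?H \<in> U}} = {x. {g. (x, g) \<in> C} \<in> U}"
      using surjective fibre_coset by (auto, metis)
    ultimately show ?thesis by simp
  qed
  ultimately show ?thesis by (auto simp: continuous_map_def)
qed

end

section \<open>Integer iterates of the skew product\<close>

text \<open>Integer exponents make the two-sided \<open>orbit\<close> of a bijection the orbit of a
  single \<open>int\<close>-action.\<close>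

definition zpow :: "('a \<Rightarrow> 'a) \<Rightarrow> int \<Rightarrow> 'a \<Rightarrow> 'a" where
  "zpow S n = (if 0 \<le> n then S ^^ nat n else inv S ^^ nat (- n))"

lemma zpow_0 [simp]: "zpow S 0 = id"
  by (simp add: zpow_def)

lemma orbit_eq_range_zpow: "orbit S p = range (\<lambda>n. zpow S n p)"
proof (intro equalityI subsetI)
  have "(S ^^ n) p = zpow S (int n) p" "(inv S ^^ n) p = zpow S (- int n) p" for n
    by (auto simp: zpow_def)
  then show "q \<in> range (\<lambda>n. zpow S n p)" if "q \<in> orbit S p" for q
    using that unfolding orbit_def by blast
  show "q \<in> orbit S p" if "q \<in> range (\<lambda>n. zpow S n p)" for q
    using that unfolding orbit_def zpow_def by (auto split: if_splits)
qed

lemma zpow_Suc: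
  assumes "bij S"
  shows "zpow S (n + 1) = S \<circ> zpow S n"
proof (cases "0 \<le> n")
  case True
  then have "nat (n + 1) = Suc (nat n)" by simp
  with True show ?thesis by (simp add: zpow_def)
next
  case False
  then obtain k where k: "n = - int (Suc k)" by (metis int_cases not_le of_nat_0_le_iff)
  have "S \<circ> inv S = id" by (auto simp: fun_eq_iff surj_f_inv_f bij_is_surj assms)
  then have "S \<circ> (inv S \<circ> inv S ^^ k) = inv S ^^ k" by (simp add: o_assoc)
  with k show ?thesis by (auto simp: zpow_def nat_add_distrib)
qed

lemma zpow_add:
  assumes "bij S"
  shows "zpow S (m + n) = zpow S m \<circ> zpow S n"
proof (induction m rule: int_induct[of _ 0])
  case (step1 i)
  then show ?case
    using zpow_Suc[OF assms, of "i + n"] zpow_Suc[OF assms, of i] by (simp add: add_ac o_assoc)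
next
  case (step2 i)
  have "S \<circ> zpow S (i - 1 + n) = zpow S (i + n)"
    using zpow_Suc[OF assms, of "i - 1 + n"] by (simp add: add.commute)
  moreover have "S \<circ> zpow S (i - 1) = zpow S i"
    using zpow_Suc[OF assms, of "i - 1"] by simp
  ultimately have "S (zpow S (i - 1 + n) x) = S (zpow S (i - 1) (zpow S n x))" for x
    using step2 by (metis comp_apply)
  then show ?case using assms by (simp add: fun_eq_iff bij_is_inj inj_eq)
qed simp

lemma continuous_zpow:
  assumes "continuous_on UNIV S" "continuous_on UNIV (inv S)"
  shows "continuous_on UNIV (zpow S n)"
proof -
  have "continuous_on UNIV (S' ^^ k)" if "continuous_on UNIV S'" for S' :: "'a::topological_space \<Rightarrow> 'a" and k
  proof (induction k)
    case (Suc k)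
    then show ?case
      using continuous_on_compose2[OF that, of UNIV "S' ^^ k"] by (simp add: o_def)
  qed (simp add: id_def)
  with assms show ?thesis by (simp add: zpow_def)
qed

text \<open>The points whose whole orbit avoids \<open>U\<close> form a closed invariant set. It
  omits the points of \<open>U\<close>, so minimality makes it empty.\<close>

lemma minimal_hom_orbit_dense:
  assumes T: "minimal_hom T" and "open U" "U \<noteq> {}"
  shows "\<exists>n. zpow T n x \<in> U"
proof -
  obtain T' where T': "homeomorphism UNIV UNIV T T'"
    using T unfolding minimal_hom_def homeomorphism_of_def by blast
  then have "bij T" "inv T = T'"
    unfolding homeomorphism_def by (auto intro!: bijI' inv_equality) metis+
  define A where "A = (\<Inter>n. zpow T n -` (- U))"
  have "closed A"
    unfolding A_def using T' \<open>inv T = T'\<close> \<open>open U\<close>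
    by (intro closed_INT ballI closed_vimage continuous_zpow) (auto simp: homeomorphism_def)
  moreover have "T ` A = A"
  proof -
    have "zpow T n (T y) = zpow T (n + 1) y" "zpow T n y = zpow T (n + 1) (T' y)" for n y
      using zpow_add[OF \<open>bij T\<close>, of n 1] T' by (auto simp: zpow_def homeomorphism_def)
    then have "T y \<in> A" "T' y \<in> A" if "y \<in> A" for y
      using that unfolding A_def by (auto, metis diff_add_cancel)
    moreover have "T (T' y) = y" for y using T' by (auto simp: homeomorphism_def)
    ultimately show ?thesis by (auto, metis image_eqI)
  qed
  moreover have "A \<noteq> UNIV"
  proof -
    obtain u where "u \<in> U" using \<open>U \<noteq> {}\<close> by blast
    then have "zpow T 0 u \<in> U" by simp
    then show ?thesis unfolding A_def by blast
  qed
  ultimately have "A = {}" using T unfolding minimal_hom_def by blast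
  then show ?thesis unfolding A_def by auto
qed

section \<open>The skew product and its cocycle\<close>

lemma skew_inverse:
  assumes "homeomorphism UNIV UNIV T T'"
  shows "bij (skew T f)" and "inv (skew T f) = (\<lambda>p. (T' (fst p), - f (T' (fst p)) + snd p))"
proof -
  let ?R = "\<lambda>p. (T' (fst p), - f (T' (fst p)) + snd p)"
  have R: "?R (skew T f p) = p" "skew T f (?R p) = p" for p
    using assms by (auto simp: skew_def homeomorphism_def group_simps simp del: add_uminus_conv_diff)
  then show "inv (skew T f) = ?R" by (rule inv_equality)
  show "bij (skew T f)" using R by (metis bijI')
qed

text \<open>Powers of the skew product commute with right translations, so their values at
  \<open>(x, 0)\<close> determine them; the group coordinate there is the cocycle
  \<open>f(n, x)\<close>.\<close>

lemma zpow_skew: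
  assumes "homeomorphism UNIV UNIV T T'"
  shows "zpow (skew T f) n (x, g) = (zpow T n x, snd (zpow (skew T f) n (x, 0)) + g)"
proof -
  have "inv T = T'" using assms unfolding homeomorphism_def by (auto intro!: inv_equality)
  \<comment> \<open>The second conjunct feeds the induction: the next iterate evaluates
    \<open>f\<close> at the first coordinate of the iterate of \<open>(x, 0)\<close>.\<close>
  have "(skew T f ^^ k) (x, g) = ((T ^^ k) x, snd ((skew T f ^^ k) (x, 0)) + g) \<and>
      fst ((skew T f ^^ k) (x, 0)) = (T ^^ k) x" for k
    by (induction k) (auto simp: skew_def group_simps simp del: add_uminus_conv_diff)
  moreover have "(inv (skew T f) ^^ k) (x, g) = ((inv T ^^ k) x, snd ((inv (skew T f) ^^ k) (x, 0)) + g) \<and>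
      fst ((inv (skew T f) ^^ k) (x, 0)) = (inv T ^^ k) x" for k
    unfolding \<open>inv T = T'\<close> skew_inverse(2)[OF assms] by (induction k) (auto simp: group_simps simp del: add_uminus_conv_diff)
  ultimately show ?thesis by (simp add: zpow_def)
qed

theorem theorem3p2:
  fixes T :: "'x::metric_space \<Rightarrow> 'x"
    and f :: "'x \<Rightarrow> 'g::{topological_group_add, second_countable_topology}"
    and C :: "('x \<times> 'g) set"
  assumes "compact (UNIV :: 'x set)"
    and "minimal_hom T"
    and "locally_compact_space (euclidean :: 'g topology)"
    and "nilpotent_group TYPE('g)"
    and "continuous_on UNIV f"
    and "regular_cocycle T f"
    and "surj_orbit_closure T f C"
  shows "(\<forall>x. \<exists>gx. {g. (x, g) \<in> C} = lcoset gx (Stab C))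
       \<and> continuous_map euclidean (quot_topology (Stab C)) (\<lambda>x. {g. (x, g) \<in> C})"
proof -
  obtain T' where T': "homeomorphism UNIV UNIV T T'"
    using assms(2) unfolding minimal_hom_def homeomorphism_of_def by blast
  then have cont_T: "continuous_on UNIV T" "continuous_on UNIV T'" and "bij T" "inv T = T'"
    unfolding homeomorphism_def by (auto intro!: bijI' inv_equality) metis+
  obtain x0 g0 where C: "C = closure (orbit (skew T f) (x0, g0))" and surj: "fst ` C = UNIV"
    using assms(7) unfolding surj_orbit_closure_def by auto
  define \<phi> where "\<phi> n x = snd (zpow (skew T f) n (x, 0))" for n x
  have skew_pow: "zpow (skew T f) n (x, g) = (zpow T n x, \<phi> n x + g)" for n x g
    unfolding \<phi>_def by (rule zpow_skew[OF T'])
  have cont_skew: "continuous_on UNIV (zpow (skew T f) n)" for n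
  proof (rule continuous_zpow)
    show "continuous_on UNIV (skew T f)"
      unfolding skew_def [abs_def]
      by (intro continuous_intros continuous_on_compose2[OF cont_T(1)]
          continuous_on_compose2[OF assms(5)]) auto
    show "continuous_on UNIV (inv (skew T f))"
      unfolding skew_inverse(2)[OF T']
      by (intro continuous_intros continuous_on_compose2[OF cont_T(2)]
          continuous_on_compose2[OF assms(5)]) auto
  qed
  have cont_\<phi>: "continuous_on UNIV (\<phi> n)" for n
  proof -
    have "continuous_on UNIV (\<lambda>x. zpow (skew T f) n (x, 0))"
      by (rule continuous_on_compose2[OF cont_skew]) (auto intro!: continuous_intros)
    then show ?thesis unfolding \<phi>_def [abs_def] by (rule continuous_on_snd)
  qed
  \<comment> \<open>The cocycle identity is the group coordinate of the power law for the skew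
    product.\<close>
  have \<phi>_add: "\<phi> (m + n) x = \<phi> m (zpow T n x) + \<phi> n x" for m n x
    using zpow_add[OF skew_inverse(1)[OF T', of f], of m n] skew_pow[of "m + n" x 0]
      skew_pow[of n x 0] skew_pow[of m "zpow T n x" "\<phi> n x"] by simp
  interpret surjective_cocycle_orbit_closure "zpow T" \<phi> x0 g0 C
  proof
    show "continuous_on UNIV (zpow T n)" for n
      using cont_T \<open>inv T = T'\<close> by (intro continuous_zpow) auto
    show "\<exists>g. (x, g) \<in> C" for x
      using surj by (metis UNIV_I imageE prod.collapse)
    show "C = closure (range (\<lambda>n. (zpow T n x0, \<phi> n x0 + g0)))"
      unfolding C orbit_eq_range_zpow skew_pow ..
  qed (use assms cont_\<phi> \<phi>_add minimal_hom_orbit_dense[OF assms(2)] zpow_add[OF \<open>bij T\<close>] in auto)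
  show ?thesis
    using surjective fibre_coset continuous_fibre by blast
qed

end
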